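(* Let $X$ be a linear space, $Y$ a Hilbert space, and $T\in LR(X,Y)$. Then $$\tilde T_s=G\big(Q_T|_{\overline{T(0)}^{\perp}}\big)\,\hat T_s ,$$ and consequently $\hat T_s$ is a (single-valued) linear operator with domain $D(T)$. Further, if $X$ is a topological linear space, then $\hat T_s\subset \overline{T}$, which implies that $\hat T_s\subset T$ in the case that $T$ is closed.
   Context: All spaces are over the same scalar field ($\mathbf R$ or $\mathbf C$). $LR(X,Y)$ is the set of all linear subspaces of $X\times Y$. For $T\in LR(X,Y)$: $D(T)$ is its domain $\{x:\exists y,\ (x,y)\in T\}$, and $T(x)=\{y\in Y:(x,y)\in T\}$. "Linear operator" means single-valued; a linear operator from (a subspace of) $X$ to $Y$ is identified with its graph, and $G(U)$ denotes the graph of an operator $U$. $T$ is (the graph of) a linear operator iff $T(0)=\{0\}$. For $T\in LR(X,Y)$ and $S\in LR(Y,Z)$, the product is $ST=\{(x,z)\in X\times Z:\exists y\in Y,\ (x,y)\in T,\ (y,z)\in S\}$. If $X$ and $Y$ are topological linear spaces, $\overline T$ is the closure of $T$ in $X\times Y$ (product topology), and $T$ is closed if $\overline T=T$. For $T\in LR(X,Y)$ with $Y$ a Hilbert space, $Q_T:Y\to Y/\overline{T(0)}$, $y\mapsto [y]=y+\overline{T(0)}$, is the natural quotient map; $Q_T|_{\overline{T(0)}^\perp}$ is its restriction to $\overline{T(0)}^\perp$; $P_T:Y\to \overline{T(0)}^\perp$ is the orthogonal projection. Define $\tilde T_s:=G(Q_T)\,T\in LR(X,Y/\overline{T(0)})$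 (this is a linear operator with domain $D(T)$) and $\hat T_s:=G(P_T)\,T\in LR(X,Y)$. *)

theory Defs
  imports "HOL-Analysis.Analysis"
begin

text \<open>
  The scalar field, \<open>\<real>\<close> or \<open>\<complex>\<close>. By the Gelfand-Mazur theorem every instance of
  \<^class>\<open>real_normed_field\<close> is isometrically isomorphic to one of these two, and the second
  axiom then forces \<open>sconj\<close> to be the identity, respectively complex conjugation.
\<close>

class real_or_complex = real_normed_field +
  fixes sconj :: "'a \<Rightarrow> 'a"
  assumes sconj_add: "sconj (a + b) = sconj a + sconj b"
    and mult_sconj_self: "a * sconj a = (norm a)\<^sup>2 *\<^sub>R 1"

instantiation real :: real_or_complex
begin
definition sconj_real :: "real \<Rightarrow> real" where "sconj_real a = a"
instance by standard (simp_all add: sconj_real_def power2_eq_square)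
end

instantiation complex :: real_or_complex
begin
definition sconj_complex :: "complex \<Rightarrow> complex" where "sconj_complex = cnj"
instance by standard (simp_all add: sconj_complex_def scaleR_conv_of_real complex_norm_square del: of_real_power)
end

text \<open>
  A Hilbert space over \<open>'k\<close>. Completeness comes from \<^class>\<open>banach\<close>, whose real scalar
  multiplication is the restriction of \<open>scale\<close> and whose norm is the one induced by \<open>ip\<close>.
\<close>

locale hilbert_space = vector_space scale
  for scale :: "'k::real_or_complex \<Rightarrow> 'y::banach \<Rightarrow> 'y" +
  fixes ip :: "'y \<Rightarrow> 'y \<Rightarrow> 'k"
  assumes scale_of_real: "scale (of_real r) y = r *\<^sub>R y"
    and ip_add_left: "ip (x + y) z = ip x z + ip y z"
    and ip_scale_left: "ip (scale c x) y = c * ip x y"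
    and ip_commute: "ip y x = sconj (ip x y)"
    and ip_self: "ip x x = of_real ((norm x)\<^sup>2)"

lemma hilbert_space_inner:
  "hilbert_space scaleR (inner :: 'y::{real_inner,banach} \<Rightarrow> 'y \<Rightarrow> real)"
  by unfold_locales
    (simp_all add: algebra_simps inner_commute sconj_real_def dot_square_norm)

lemma hilbert_space_complex:
  "hilbert_space (*) (\<lambda>x y :: complex. x * cnj y)"
  by unfold_locales
    (simp_all add: algebra_simps sconj_complex_def scaleR_conv_of_real complex_norm_square
      del: of_real_power)

text \<open>The topology is an explicit parameter; no separation axiom is required.\<close>

locale topological_linear_space = vector_space scale
  for scale :: "'k::real_normed_field \<Rightarrow> 'x::ab_group_add \<Rightarrow> 'x" +
  fixes \<tau> :: "'x topology"
  assumes topspace_UNIV: "topspace \<tau> = UNIV"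
    and continuous_add: "continuous_map (prod_topology \<tau> \<tau>) \<tau> (\<lambda>(x, y). x + y)"
    and continuous_scale: "continuous_map (prod_topology euclidean \<tau>) \<tau> (\<lambda>(c, x). scale c x)"

text \<open>
  A relation \<open>T\<close> is a set of pairs, so \<open>D(T)\<close> is \<^term>\<open>Domain T\<close>, \<open>T(x)\<close> is \<^term>\<open>T `` {x}\<close> and
  the product \<open>S T\<close> is \<^term>\<open>T O S\<close>, with the factors in diagrammatic order.
\<close>

definition LR :: "('k::field \<Rightarrow> 'x::ab_group_add \<Rightarrow> 'x) \<Rightarrow> ('k \<Rightarrow> 'y::ab_group_add \<Rightarrow> 'y) \<Rightarrow>
    ('x \<times> 'y) set set" where
  "LR sX sY = {T. module.subspace (module_prod.scale sX sY) T}"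

definition graph_on :: "'a set \<Rightarrow> ('a \<Rightarrow> 'b) \<Rightarrow> ('a \<times> 'b) set" where
  "graph_on A f = {(a, f a) | a. a \<in> A}"

definition closed_mul :: "('x::zero \<times> 'y::topological_space) set \<Rightarrow> 'y set" where
  "closed_mul T = closure (T `` {0})"

text \<open>The quotient map \<open>y \<mapsto> y + M\<close>; elements of the quotient are cosets.\<close>

definition quot_map :: "'y::plus set \<Rightarrow> 'y \<Rightarrow> 'y set" where
  "quot_map M y = (\<lambda>m. y + m) ` M"

definition orth_compl :: "('y \<Rightarrow> 'y \<Rightarrow> 'k::zero) \<Rightarrow> 'y set \<Rightarrow> 'y set" where
  "orth_compl ip M = {y. \<forall>m\<in>M. ip y m = 0}"

definition orth_proj :: "('y::minus \<Rightarrow> 'y \<Rightarrow> 'k::zero) \<Rightarrow> 'y set \<Rightarrow> 'y \<Rightarrow> 'y" where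
  "orth_proj ip N y = (THE p. p \<in> N \<and> y - p \<in> orth_compl ip N)"

definition T_tilde :: "('x::zero \<times> 'y::{plus,topological_space}) set \<Rightarrow> ('x \<times> 'y set) set" where
  "T_tilde T = T O graph_on UNIV (quot_map (closed_mul T))"

definition T_hat :: "('y \<Rightarrow> 'y \<Rightarrow> 'k::zero) \<Rightarrow>
    ('x::zero \<times> 'y::{minus,topological_space}) set \<Rightarrow> ('x \<times> 'y) set" where
  "T_hat ip T = T O graph_on UNIV (orth_proj ip (orth_compl ip (closed_mul T)))"

end

theory Submission
  imports Defs
begin

text \<open>
  Write \<open>M\<close> for the closure of \<open>T(0)\<close> and \<open>P\<close> for the orthogonal projection onto its orthogonal
  complement. The whole theorem rests on the projection theorem for the closed subspace \<open>M\<close>: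
  every \<open>y\<close> differs from \<open>P y\<close> by an element of \<open>M\<close>, and \<open>P y\<close> is the only vector orthogonal
  to \<open>M\<close> with this property (\<open>orth_proj_mem\<close>, \<open>diff_orth_proj_mem\<close>, \<open>orth_proj_eqI\<close>).

  Hence \<open>y\<close> and \<open>P y\<close> lie in the same coset of \<open>M\<close>, which is the factorisation of the quotient
  operator through \<open>P T\<close>. Two values of \<open>T\<close> at the same point differ by an element of \<open>T(0)\<close>, so
  they have the same projection, and \<open>P T\<close> is single-valued. Finally, for \<open>(x, y) \<in> T\<close> the values of
  \<open>T\<close> at \<open>x\<close> form the translate \<open>y - T(0)\<close>, whose closure is \<open>y - M\<close>; this contains
  \<open>P y = y - (y - P y)\<close>, and so \<open>(x, P y)\<close> is a limit of points of \<open>T\<close> already along the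
  fibre over \<open>x\<close>.

  The projection theorem over an abstract scalar field is obtained in the classical way: the
  parallelogram law makes near-minimisers of the distance to \<open>M\<close> cluster, completeness yields a
  nearest point, and a nearest point leaves an orthogonal residual.
\<close>

section \<open>Inner product identities\<close>

lemma sconj_0: "sconj (0 :: 'k::real_or_complex) = 0"
  using sconj_add[of 0 "0::'k"] by simp

lemma sconj_of_real: "sconj (of_real r) = (of_real r :: 'k::real_or_complex)"
proof (cases "r = 0")
  case True
  then show ?thesis by (simp add: sconj_0)
next
  case False
  have "of_real r * sconj (of_real r) = (of_real r * of_real r :: 'k)"
    using mult_sconj_self[of "of_real r :: 'k"]
    by (simp add: scaleR_conv_of_real power2_eq_square flip: of_real_mult)
  with False show ?thesis by simp
qed

context hilbert_space
begin

lemma ip_zero_left: "ip 0 z = 0"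
  using ip_add_left[of 0 0 z] by simp

lemma ip_diff_left: "ip (x - y) z = ip x z - ip y z"
  using ip_add_left[of "x - y" y z] by simp

lemma ip_add_right: "ip z (x + y) = ip z x + ip z y"
  using ip_commute[of z "x + y"] ip_commute[of z x] ip_commute[of z y]
  by (simp add: ip_add_left sconj_add)

lemma ip_diff_right: "ip z (x - y) = ip z x - ip z y"
  using ip_add_right[of z "x - y" y] by simp

lemma ip_eq_0_commute: "ip x y = 0 \<Longrightarrow> ip y x = 0"
  by (simp add: ip_commute[of y x] sconj_0)

lemma parallelogram_law:
  fixes x y :: 'y
  shows "(norm (x + y))\<^sup>2 + (norm (x - y))\<^sup>2 = 2 * (norm x)\<^sup>2 + 2 * (norm y)\<^sup>2"
proof -
  have "(of_real ((norm (x + y))\<^sup>2 + (norm (x - y))\<^sup>2) :: 'k)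
      = of_real (2 * (norm x)\<^sup>2 + 2 * (norm y)\<^sup>2)"
    unfolding of_real_add of_real_mult ip_self[symmetric]
    by (simp add: ip_add_left ip_add_right ip_diff_left ip_diff_right)
  then show ?thesis unfolding of_real_eq_iff .
qed

lemma norm_scale: "norm (scale c x) = norm c * norm x"
proof -
  have "of_real ((norm (scale c x))\<^sup>2) = c * sconj (c * ip x x)"
    unfolding ip_self[symmetric] ip_scale_left ip_commute[of x "scale c x"] ..
  also have "\<dots> = of_real ((norm c * norm x)\<^sup>2)"
  proof (cases "x = 0")
    case True
    then show ?thesis by (simp add: ip_zero_left sconj_0)
  next
    case False
    \<comment> \<open>The axioms do not say that \<open>sconj\<close> is multiplicative, so \<open>c * ip x x\<close> is treated as a
      single scalar \<open>w\<close>, and \<open>w * sconj w\<close> is known.\<close>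
    have "(c * ip x x) * sconj (c * ip x x) = of_real ((norm (c * ip x x))\<^sup>2)"
      by (simp only: mult_sconj_self scaleR_conv_of_real mult_1_right)
    also have "\<dots> = ip x x * of_real ((norm c * norm x)\<^sup>2)"
      by (simp add: ip_self norm_mult power_mult_distrib power2_eq_square)
    finally show ?thesis
      using False by (simp add: ip_self mult_ac)
  qed
  finally have "(norm (scale c x))\<^sup>2 = (norm c * norm x)\<^sup>2"
    unfolding of_real_eq_iff .
  then show ?thesis by (simp add: power2_eq_iff_nonneg)
qed

text \<open>
  Scalar multiplication by \<open>c\<close> commutes with real scaling and is bounded by \<open>norm c\<close>, so it
  is a bounded real-linear map. This makes closures of subspaces stable under all scalars.
\<close>

lemma continuous_on_scale_right: "continuous_on S (scale c)"
proof -
  have "bounded_linear (scale c)"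
  proof (rule bounded_linear_intro[where K = "norm c"])
    show "scale c (r *\<^sub>R x) = r *\<^sub>R scale c x" for r x
      by (simp add: mult.commute flip: scale_of_real)
  qed (simp_all add: scale_right_distrib norm_scale mult.commute)
  then show ?thesis by (rule linear_continuous_on)
qed

lemma subspace_closure:
  assumes "subspace S"
  shows "subspace (closure S)"
proof (rule subspaceI)
  show "0 \<in> closure S"
    using subspace_0[OF assms] closure_subset by blast
next
  fix x y assume "x \<in> closure S" "y \<in> closure S"
  then obtain f g where "\<And>n. f n \<in> S" "f \<longlonglongrightarrow> x" "\<And>n. g n \<in> S" "g \<longlonglongrightarrow> y"
    unfolding closure_sequential by blast
  then show "x + y \<in> closure S"
    unfolding closure_sequential
    by (intro exI[of _ "\<lambda>n. f n + g n"]) (auto intro: tendsto_add subspace_add[OF assms])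
next
  fix c x assume "x \<in> closure S"
  moreover have "scale c ` closure S \<subseteq> closure S"
    using subspace_scale[OF assms] closure_subset[of S]
    by (intro image_closure_subset continuous_on_scale_right) auto
  ultimately show "scale c x \<in> closure S" by blast
qed

section \<open>The projection theorem\<close>

text \<open>
  The sets \<open>S n\<close> of near-minimisers are closed, nested and nonempty. Since the midpoint of two
  of them is again in \<open>M\<close>, the parallelogram law forces them to be close to each other, so the
  diameters shrink to \<open>0\<close> and completeness gives a common point of all \<open>S n\<close>. Squared distances
  are minimised because they are what the parallelogram law controls.
\<close>

lemma nearest_point_exists:
  assumes "closed M" "subspace M"
  obtains m where "m \<in> M" "\<And>n. n \<in> M \<Longrightarrow> norm (y - m) \<le> norm (y - n)"
proof -
  define D where "D = (INF m\<in>M. (norm (y - m))\<^sup>2)"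
  define S where "S n = M \<inter> {m. (norm (y - m))\<^sup>2 \<le> D + 1 / Suc n}" for n :: nat
  have bdd: "bdd_below ((\<lambda>m. (norm (y - m))\<^sup>2) ` M)"
    by (rule bdd_belowI[of _ 0]) auto
  have D_le: "D \<le> (norm (y - m))\<^sup>2" if "m \<in> M" for m
    unfolding D_def using that by (intro cINF_lower bdd)
  have "closed (S n)" for n
    unfolding S_def
    by (intro closed_Int assms closed_Collect_le continuous_intros)
  moreover have "S n \<noteq> {}" for n
  proof -
    have "D < D + 1 / Suc n" by simp
    then obtain m where "m \<in> M" "(norm (y - m))\<^sup>2 < D + 1 / Suc n"
      using cINF_less_iff[OF _ bdd] subspace_0[OF assms(2)] unfolding D_def by blast
    then show ?thesis unfolding S_def by (auto intro: less_imp_le)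
  qed
  moreover have "S n \<subseteq> S k" if "k \<le> n" for k n
  proof -
    have "1 / real (Suc n) \<le> 1 / real (Suc k)"
      using that by (intro divide_left_mono) auto
    then show ?thesis unfolding S_def by auto
  qed
  moreover have "\<exists>n. \<forall>a\<in>S n. \<forall>b\<in>S n. dist a b < e" if "e > 0" for e
  proof -
    have "0 < e\<^sup>2 / 4" using that by simp
    then obtain n where n: "1 / real (Suc n) < e\<^sup>2 / 4" by (rule nat_approx_posE)
    have "dist a b < e" if ab: "a \<in> S n" "b \<in> S n" for a b
    proof -
      define h where "h = (1/2) *\<^sub>R (a + b)"
      have "h \<in> M"
        using ab unfolding h_def S_def scale_of_real[symmetric]
        by (auto intro: subspace_scale[OF assms(2)] subspace_add[OF assms(2)])
      have sum_eq: "(y - a) + (y - b) = 2 *\<^sub>R (y - h)"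
        by (simp add: h_def scaleR_right_diff_distrib) (simp add: scaleR_2)
      have "(norm (a - b))\<^sup>2 = (norm ((y - a) - (y - b)))\<^sup>2"
        by (simp add: norm_minus_commute)
      also have "\<dots> = 2 * (norm (y - a))\<^sup>2 + 2 * (norm (y - b))\<^sup>2
          - (norm ((y - a) + (y - b)))\<^sup>2"
        using parallelogram_law[of "y - a" "y - b"] by linarith
      also have "\<dots> = 2 * (norm (y - a))\<^sup>2 + 2 * (norm (y - b))\<^sup>2 - 4 * (norm (y - h))\<^sup>2"
        by (simp only: sum_eq norm_scaleR power_mult_distrib) simp
      also have "\<dots> \<le> 4 * (1 / Suc n)"
        using ab D_le[OF \<open>h \<in> M\<close>] unfolding S_def by (simp add: algebra_simps)
      also have "\<dots> < e\<^sup>2" using n by simp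
      finally show ?thesis
        using \<open>e > 0\<close> by (simp add: dist_norm power_less_imp_less_base)
    qed
    then show ?thesis by blast
  qed
  ultimately obtain m where m: "\<And>n. m \<in> S n"
    using decreasing_closed_nest[of S] by metis
  have "(norm (y - m))\<^sup>2 \<le> D"
  proof (rule field_le_epsilon)
    fix e :: real assume "e > 0"
    then obtain n where "1 / real (Suc n) < e" by (rule nat_approx_posE)
    with m[of n] show "(norm (y - m))\<^sup>2 \<le> D + e" by (simp add: S_def)
  qed
  then have "norm (y - m) \<le> norm (y - n)" if "n \<in> M" for n
    using D_le[OF that] by (blast intro: power2_le_imp_le order_trans norm_ge_zero)
  moreover have "m \<in> M" using m[of 0] by (simp add: S_def)
  ultimately show ?thesis using that by blast
qed

text \<open>
  If \<open>d\<close> were not orthogonal to some \<open>m \<in> M\<close>, then subtracting from \<open>d\<close> its component along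
  \<open>m\<close> would shorten it strictly.
\<close>

lemma minimal_imp_orth_compl:
  assumes M: "subspace M" and min: "\<And>m. m \<in> M \<Longrightarrow> norm d \<le> norm (d - m)"
  shows "d \<in> orth_compl ip M"
  unfolding orth_compl_def
proof safe
  fix m assume "m \<in> M"
  show "ip d m = 0"
  proof (cases "m = 0")
    case True
    then show ?thesis using ip_eq_0_commute ip_zero_left by blast
  next
    case False
    define a where "a = ip d m"
    define r where "r = (norm a)\<^sup>2 / (norm m)\<^sup>2"
    define q where "q = scale (a / of_real ((norm m)\<^sup>2)) m"
    \<comment> \<open>\<open>q\<close> is the component of \<open>d\<close> along \<open>m\<close>, and \<open>r\<close> its squared norm: the inner
      products of \<open>q\<close> with \<open>d\<close>, in either order, and with itself all equal \<open>r\<close>.\<close>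
    have c_sconj: "a / of_real ((norm m)\<^sup>2) * sconj a = of_real r"
      using mult_sconj_self[of a] by (simp add: r_def scaleR_conv_of_real)
    have qd: "ip q d = of_real r"
      using c_sconj ip_commute[of m d] by (simp add: q_def ip_scale_left a_def)
    have dq: "ip d q = of_real r"
      by (simp add: ip_commute[of d q] qd sconj_of_real)
    have "ip q m = a"
      using False by (simp add: q_def ip_scale_left ip_self)
    then have qq: "ip q q = of_real r"
      using c_sconj ip_commute[of m q] by (simp add: q_def ip_scale_left)
    have "of_real ((norm (d - q))\<^sup>2) = (of_real ((norm d)\<^sup>2 - r) :: 'k)"
      unfolding of_real_diff ip_self[symmetric]
      by (simp add: ip_diff_left ip_diff_right qd dq qq)
    then have "(norm (d - q))\<^sup>2 = (norm d)\<^sup>2 - r"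
      unfolding of_real_eq_iff .
    moreover have "(norm d)\<^sup>2 \<le> (norm (d - q))\<^sup>2"
      using min[of q] subspace_scale[OF M \<open>m \<in> M\<close>] by (simp add: q_def power_mono)
    ultimately have "r \<le> 0" by simp
    with False show ?thesis by (simp add: r_def a_def divide_le_0_iff)
  qed
qed

lemma subspace_orth_compl: "subspace (orth_compl ip M)"
  by (rule subspaceI) (auto simp: orth_compl_def ip_zero_left ip_add_left ip_scale_left)

text \<open>
  The residual condition is \<open>y - p \<in> M\<close> rather than membership in the double complement: it is
  the form in which decompositions arise, and it yields additivity, homogeneity and the kernel of
  the projection by just exhibiting the decomposition.
\<close>

lemma orth_proj_eqI:
  assumes p: "p \<in> orth_compl ip M" and m: "y - p \<in> M"
  shows "orth_proj ip (orth_compl ip M) y = p"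
  unfolding orth_proj_def
proof (rule the_equality)
  show "p \<in> orth_compl ip M \<and> y - p \<in> orth_compl ip (orth_compl ip M)"
    using p m ip_eq_0_commute by (auto simp: orth_compl_def)
next
  fix q assume q: "q \<in> orth_compl ip M \<and> y - q \<in> orth_compl ip (orth_compl ip M)"
  have pq: "p - q \<in> orth_compl ip M"
    using subspace_diff[OF subspace_orth_compl] p q by blast
  \<comment> \<open>\<open>p - q\<close> is orthogonal to itself, being also a difference of two vectors of the double
    complement.\<close>
  have "ip (y - q) (p - q) = 0" "ip (y - p) (p - q) = 0"
    using q pq m ip_eq_0_commute by (auto simp: orth_compl_def)
  then have "ip (p - q) (p - q) = 0"
    using ip_diff_left[of "y - q" "y - p" "p - q"] by simp
  then show "q = p" by (simp add: ip_self)
qed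

lemma orthogonal_decomposition:
  assumes "closed M" "subspace M"
  obtains p where "p \<in> orth_compl ip M" "y - p \<in> M"
proof -
  obtain m where m: "m \<in> M" and nearest: "\<And>n. n \<in> M \<Longrightarrow> norm (y - m) \<le> norm (y - n)"
    using nearest_point_exists[OF assms] by blast
  have "y - m \<in> orth_compl ip M"
  proof (rule minimal_imp_orth_compl[OF assms(2)])
    show "norm (y - m) \<le> norm (y - m - n)" if "n \<in> M" for n
      using nearest[of "m + n"] subspace_add[OF assms(2) m that] by (simp add: diff_diff_eq)
  qed
  with m show ?thesis using that[of "y - m"] by simp
qed

lemma
  assumes "closed M" "subspace M"
  shows orth_proj_mem: "orth_proj ip (orth_compl ip M) y \<in> orth_compl ip M"
    and diff_orth_proj_mem: "y - orth_proj ip (orth_compl ip M) y \<in> M"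
proof -
  obtain p where "p \<in> orth_compl ip M" "y - p \<in> M"
    using orthogonal_decomposition[OF assms] by blast
  then show "orth_proj ip (orth_compl ip M) y \<in> orth_compl ip M"
    and "y - orth_proj ip (orth_compl ip M) y \<in> M"
    using orth_proj_eqI by auto
qed

lemma orth_proj_add:
  assumes "closed M" "subspace M"
  shows "orth_proj ip (orth_compl ip M) (y + z)
    = orth_proj ip (orth_compl ip M) y + orth_proj ip (orth_compl ip M) z"
proof (rule orth_proj_eqI)
  show "orth_proj ip (orth_compl ip M) y + orth_proj ip (orth_compl ip M) z \<in> orth_compl ip M"
    by (intro subspace_add[OF subspace_orth_compl] orth_proj_mem assms)
  show "y + z - (orth_proj ip (orth_compl ip M) y + orth_proj ip (orth_compl ip M) z) \<in> M"
    using subspace_add[OF assms(2) diff_orth_proj_mem[OF assms] diff_orth_proj_mem[OF assms]]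
    by (simp add: algebra_simps)
qed

lemma orth_proj_scale:
  assumes "closed M" "subspace M"
  shows "orth_proj ip (orth_compl ip M) (scale c y) = scale c (orth_proj ip (orth_compl ip M) y)"
proof (rule orth_proj_eqI)
  show "scale c (orth_proj ip (orth_compl ip M) y) \<in> orth_compl ip M"
    by (intro subspace_scale[OF subspace_orth_compl] orth_proj_mem assms)
  show "scale c y - scale c (orth_proj ip (orth_compl ip M) y) \<in> M"
    using subspace_scale[OF assms(2) diff_orth_proj_mem[OF assms]]
    by (simp flip: scale_right_diff_distrib)
qed

lemma orth_proj_eq_0:
  assumes "y \<in> M"
  shows "orth_proj ip (orth_compl ip M) y = 0"
  using assms by (intro orth_proj_eqI) (simp_all add: subspace_0[OF subspace_orth_compl])

text \<open>
  A vector and its projection differ by an element of \<open>M\<close>, and translating by it permutes \<open>M\<close>.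
\<close>

lemma quot_map_orth_proj:
  assumes "closed M" "subspace M"
  shows "quot_map M (orth_proj ip (orth_compl ip M) y) = quot_map M y"
proof -
  define n where "n = y - orth_proj ip (orth_compl ip M) y"
  have n: "n \<in> M" unfolding n_def by (rule diff_orth_proj_mem[OF assms])
  have "quot_map M y = (+) (orth_proj ip (orth_compl ip M) y) ` (+) n ` M"
    by (simp add: quot_map_def image_image n_def)
  also have "(+) n ` M = M"
  proof
    show "(+) n ` M \<subseteq> M" using subspace_add[OF assms(2) n] by blast
    show "M \<subseteq> (+) n ` M"
    proof
      fix m assume "m \<in> M"
      then have "m - n \<in> M" using subspace_diff[OF assms(2)] n by blast
      then show "m \<in> (+) n ` M" by (intro image_eqI[of _ _ "m - n"]) simp_all
    qed
  qed
  finally show ?thesis by (simp add: quot_map_def)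
qed

end

section \<open>Linear relations\<close>

lemma LR_iff:
  assumes "vector_space sX" "vector_space sY"
  shows "T \<in> LR sX sY \<longleftrightarrow>
    (0, 0) \<in> T \<and>
    (\<forall>x y x' y'. (x, y) \<in> T \<longrightarrow> (x', y') \<in> T \<longrightarrow> (x + x', y + y') \<in> T) \<and>
    (\<forall>c x y. (x, y) \<in> T \<longrightarrow> (sX c x, sY c y) \<in> T)"
proof -
  interpret vector_space_prod sX sY
    using assms by (simp add: vector_space_prod_def vector_space_pair_def)
  show ?thesis
    by (simp add: LR_def p.subspace_def scale_prod zero_prod_def Ball_def split_paired_All)
qed

lemma LR_diff:
  assumes "vector_space sX" "vector_space sY" "T \<in> LR sX sY" "(x, y) \<in> T" "(x', y') \<in> T"
  shows "(x - x', y - y') \<in> T"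
proof -
  interpret X: vector_space sX by fact
  interpret Y: vector_space sY by fact
  note T = assms(3)[unfolded LR_iff[OF assms(1,2)]]
  have "(sX (-1) x', sY (-1) y') \<in> T"
    using T assms(5) by blast
  then have "(x + sX (-1) x', y + sY (-1) y') \<in> T"
    using T assms(4) by blast
  then show ?thesis by simp
qed

lemma subspace_LR_Image_0:
  assumes "vector_space sX" "vector_space sY" "T \<in> LR sX sY"
  shows "module.subspace sY (T `` {0})"
proof -
  interpret X: vector_space sX by fact
  interpret Y: vector_space sY by fact
  note T = assms(3)[unfolded LR_iff[OF assms(1,2)]]
  show ?thesis
  proof (rule Y.subspaceI)
    show "y + z \<in> T `` {0}" if "y \<in> T `` {0}" "z \<in> T `` {0}" for y z
      using T that by (metis Image_singleton_iff add_0)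
    show "sY c y \<in> T `` {0}" if "y \<in> T `` {0}" for c y
      using T that by (metis Image_singleton_iff X.scale_zero_right)
  qed (use T in simp)
qed

lemma T_tilde_iff: "(x, q) \<in> T_tilde T \<longleftrightarrow> (\<exists>y. (x, y) \<in> T \<and> q = quot_map (closed_mul T) y)"
  by (auto simp: T_tilde_def graph_on_def)

lemma T_hat_iff:
  "(x, p) \<in> T_hat ip T \<longleftrightarrow>
    (\<exists>y. (x, y) \<in> T \<and> p = orth_proj ip (orth_compl ip (closed_mul T)) y)"
  by (auto simp: T_hat_def graph_on_def)

text \<open>
  Keeping the first coordinate fixed already suffices to approximate: \<open>(x, y - m)\<close> with
  \<open>m \<in> T(0)\<close> stays in \<open>T\<close> and tends to \<open>(x, y - u)\<close> as \<open>m\<close> tends to \<open>u\<close>.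
\<close>

lemma LR_translate_closed_mul_in_closure:
  fixes sY :: "'k::field \<Rightarrow> 'y::real_normed_vector \<Rightarrow> 'y"
  assumes "vector_space sX" "vector_space sY" "T \<in> LR sX sY" "x \<in> topspace \<tau>"
    and xy: "(x, y) \<in> T" and u: "u \<in> closed_mul T"
  shows "(x, y - u) \<in> prod_topology \<tau> euclidean closure_of T"
  unfolding in_closure_of
proof (intro conjI allI impI)
  show "(x, y - u) \<in> topspace (prod_topology \<tau> euclidean)"
    using assms(4) by simp
  fix W assume W: "(x, y - u) \<in> W \<and> openin (prod_topology \<tau> euclidean) W"
  then have "\<exists>U V. openin \<tau> U \<and> openin euclidean V \<and> x \<in> U \<and> y - u \<in> V \<and> U \<times> V \<subseteq> W"
    by (simp only: openin_prod_topology_alt)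
  then obtain U V where UV: "open V" "x \<in> U" "y - u \<in> V" "U \<times> V \<subseteq> W"
    by (metis open_openin)
  have "(\<lambda>v. y - v) ` closure (T `` {0}) \<subseteq> closure ((\<lambda>v. y - v) ` (T `` {0}))"
    by (intro image_closure_subset continuous_intros closed_closure closure_subset)
  then have "y - u \<in> closure ((\<lambda>v. y - v) ` (T `` {0}))"
    using u unfolding closed_mul_def by blast
  then have "(\<lambda>v. y - v) ` (T `` {0}) \<inter> V \<noteq> {}"
    using UV by (meson closure_iff_nhds_not_empty order_refl)
  then obtain m where m: "(0, m) \<in> T" "y - m \<in> V" by auto
  have "(x, y - m) \<in> T"
    using LR_diff[OF assms(1-3) xy m(1)] by simp
  with m UV show "\<exists>w. w \<in> T \<and> w \<in> W" by blast
qed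

section \<open>The single-valued part\<close>


theorem theorem2p1:
  fixes sX :: "'k::real_or_complex \<Rightarrow> 'x::ab_group_add \<Rightarrow> 'x"
    and sY :: "'k \<Rightarrow> 'y::banach \<Rightarrow> 'y"
    and ip :: "'y \<Rightarrow> 'y \<Rightarrow> 'k"
    and T :: "('x \<times> 'y) set"
  assumes "vector_space sX"
    and "hilbert_space sY ip"
    and "T \<in> LR sX sY"
  shows "T_tilde T =
           T_hat ip T O graph_on (orth_compl ip (closed_mul T)) (quot_map (closed_mul T)) \<and>
         T_hat ip T \<in> LR sX sY \<and> single_valued (T_hat ip T) \<and> Domain (T_hat ip T) = Domain T \<and>
         (\<forall>\<tau>. topological_linear_space sX \<tau> \<longrightarrow>
           T_hat ip T \<subseteq> prod_topology \<tau> euclidean closure_of T \<and>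
           (prod_topology \<tau> euclidean closure_of T = T \<longrightarrow> T_hat ip T \<subseteq> T))"
proof -
  interpret X: vector_space sX by fact
  interpret Y: hilbert_space sY ip by fact
  note vs = assms(1) Y.vector_space_axioms
  define M where "M = closed_mul T"
  define P where "P = orth_proj ip (orth_compl ip M)"
  have "closed M" by (simp add: M_def closed_mul_def)
  moreover have "Y.subspace M"
    unfolding M_def closed_mul_def
    by (intro Y.subspace_closure subspace_LR_Image_0[OF vs assms(3)])
  ultimately have M: "closed M" "Y.subspace M" .
  have hat: "(x, p) \<in> T_hat ip T \<longleftrightarrow> (\<exists>y. (x, y) \<in> T \<and> p = P y)" for x p
    by (simp add: T_hat_iff P_def M_def)
  have T: "(0, 0) \<in> T" "\<And>x y x' y'. (x, y) \<in> T \<Longrightarrow> (x', y') \<in> T \<Longrightarrow> (x + x', y + y') \<in> T"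
    "\<And>c x y. (x, y) \<in> T \<Longrightarrow> (sX c x, sY c y) \<in> T"
    using assms(3) unfolding LR_iff[OF vs] by blast+
  have P_add: "P (y + z) = P y + P z" and P_scale: "P (sY c y) = sY c (P y)" for c y z
    using Y.orth_proj_add[OF M] Y.orth_proj_scale[OF M] by (simp_all add: P_def)
  have P_0: "P y = 0" if "y \<in> M" for y
    using Y.orth_proj_eq_0[OF that] by (simp add: P_def)
  have P_mem: "P y \<in> orth_compl ip M" and quot_P: "quot_map M (P y) = quot_map M y"
    and diff_P: "y - P y \<in> M" for y
    unfolding P_def using Y.orth_proj_mem Y.quot_map_orth_proj Y.diff_orth_proj_mem M by blast+

  have "(x, q) \<in> T_tilde T \<longleftrightarrow>
      (x, q) \<in> T_hat ip T O graph_on (orth_compl ip M) (quot_map M)" for x q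
  proof -
    have "(x, q) \<in> T_hat ip T O graph_on (orth_compl ip M) (quot_map M) \<longleftrightarrow>
        (\<exists>y. (x, y) \<in> T \<and> P y \<in> orth_compl ip M \<and> q = quot_map M (P y))"
      unfolding relcomp.simps hat graph_on_def by auto
    then show ?thesis
      by (simp add: P_mem quot_P T_tilde_iff M_def[symmetric])
  qed
  then have factor: "T_tilde T = T_hat ip T O graph_on (orth_compl ip M) (quot_map M)"
    by auto

  have linear: "T_hat ip T \<in> LR sX sY"
    unfolding LR_iff[OF vs]
  proof (intro conjI allI impI)
    have "0 \<in> M" using Y.subspace_0[OF M(2)] .
    with T(1) show "(0, 0) \<in> T_hat ip T" unfolding hat using P_0 by metis
  next
    fix x p x' p' assume "(x, p) \<in> T_hat ip T" "(x', p') \<in> T_hat ip T"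
    then show "(x + x', p + p') \<in> T_hat ip T"
      unfolding hat using T(2) P_add by metis
  next
    fix c x p assume "(x, p) \<in> T_hat ip T"
    then show "(sX c x, sY c p) \<in> T_hat ip T"
      unfolding hat using T(3) P_scale by metis
  qed

  have single: "single_valued (T_hat ip T)"
  proof (rule single_valuedI)
    fix x p p' assume "(x, p) \<in> T_hat ip T" "(x, p') \<in> T_hat ip T"
    then obtain y y' where y: "(x, y) \<in> T" "p = P y" and y': "(x, y') \<in> T" "p' = P y'"
      unfolding hat by blast
    have "y - y' \<in> M"
      using LR_diff[OF vs assms(3) y(1) y'(1)] closure_subset
      unfolding M_def closed_mul_def by fastforce
    then show "p = p'"
      using P_add[of "y - y'" y'] P_0 y(2) y'(2) by simp
  qed

  have dom: "Domain (T_hat ip T) = Domain T"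
    unfolding Domain_iff set_eq_iff hat by blast

  have closure: "T_hat ip T \<subseteq> prod_topology \<tau> euclidean closure_of T"
    if "topological_linear_space sX \<tau>" for \<tau>
  proof (rule subrelI)
    fix x p assume "(x, p) \<in> T_hat ip T"
    then obtain y where y: "(x, y) \<in> T" "p = P y" unfolding hat by blast
    have "x \<in> topspace \<tau>"
      using topological_linear_space.topspace_UNIV[OF that] by simp
    from LR_translate_closed_mul_in_closure[OF vs assms(3) this y(1) diff_P[of y, unfolded M_def]]
    show "(x, p) \<in> prod_topology \<tau> euclidean closure_of T"
      by (simp add: y(2))
  qed

  show ?thesis
    using factor linear single dom closure unfolding M_def by metis
qed

end
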